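(* For all integers $s,t,k$ with $2\leq s<t$, $t\geq 5$ and $t+s-\lfloor t/2\rfloor\leq k\leq t+s$, $$\operatorname{bgr}_k(K_{1,3}:K_{s,t})=t+s.$$
   Context: All graphs are finite, simple and undirected. $K_{a,b}$ denotes the complete bipartite graph with parts of sizes $a$ and $b$. A $k$-edge-coloring (not necessarily proper) is exact if all $k$ colors are used at least once. A copy of a graph in an edge-colored graph is a (not necessarily induced) subgraph isomorphic to it; it is rainbow if no two of its edges have the same color and monochromatic if all its edges have the same color. The $k$-colored bipartite Gallai-Ramsey number $\operatorname{bgr}_k(G:H)$ is the minimum integer $n$ such that $n^2\geq k$ and for every $N\geq n$, every exact $k$-edge-coloring of the complete bipartite graph $K_{N,N}$ contains either a rainbow copy of $G$ or a monochromatic copy of $H$. *)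

theory Defs
  imports Main "HOL-Library.Extended_Nat"
begin

type_synonym 'a graph = "'a set \<times> 'a set set"

abbreviation verts :: "'a graph \<Rightarrow> 'a set" where
  "verts \<equiv> fst"

abbreviation edges :: "'a graph \<Rightarrow> 'a set set" where
  "edges \<equiv> snd"

definition simple_graph :: "'a graph \<Rightarrow> bool" where
  "simple_graph G \<longleftrightarrow> finite (verts G) \<and> (\<forall>e\<in>edges G. e \<subseteq> verts G \<and> card e = 2)"

definition subgraph :: "'a graph \<Rightarrow> 'a graph \<Rightarrow> bool" where
  "subgraph F G \<longleftrightarrow> simple_graph F \<and> verts F \<subseteq> verts G \<and> edges F \<subseteq> edges G"

definition isomorphic :: "'a graph \<Rightarrow> 'b graph \<Rightarrow> bool" where
  "isomorphic G H \<longleftrightarrow>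
     (\<exists>f. bij_betw f (verts G) (verts H) \<and> (\<lambda>e. f ` e) ` edges G = edges H)"

definition is_copy :: "'a graph \<Rightarrow> 'b graph \<Rightarrow> 'b graph \<Rightarrow> bool" where
  "is_copy G F host \<longleftrightarrow> subgraph F host \<and> isomorphic F G"

definition complete_bipartite :: "nat \<Rightarrow> nat \<Rightarrow> (nat + nat) graph" where
  "complete_bipartite a b =
     (Inl ` {..<a} \<union> Inr ` {..<b}, {{Inl i, Inr j} | i j. i < a \<and> j < b})"

lemma simple_graph_complete_bipartite: "simple_graph (complete_bipartite a b)"
  by (auto simp: simple_graph_def complete_bipartite_def)

text \<open>The \<open>k\<close> colors are \<open>0, \<dots>, k - 1\<close>; values of \<open>c\<close> outside the edge set are irrelevant.\<close>

definition exact_edge_coloring :: "nat \<Rightarrow> 'a graph \<Rightarrow> ('a set \<Rightarrow> nat) \<Rightarrow> bool" where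
  "exact_edge_coloring k G c \<longleftrightarrow> c ` edges G = {..<k}"

definition rainbow :: "('a set \<Rightarrow> nat) \<Rightarrow> 'a graph \<Rightarrow> bool" where
  "rainbow c F \<longleftrightarrow> inj_on c (edges F)"

definition monochromatic :: "('a set \<Rightarrow> nat) \<Rightarrow> 'a graph \<Rightarrow> bool" where
  "monochromatic c F \<longleftrightarrow> (\<forall>e\<in>edges F. \<forall>e'\<in>edges F. c e = c e')"

definition bgr_bound :: "nat \<Rightarrow> 'a graph \<Rightarrow> 'b graph \<Rightarrow> nat \<Rightarrow> bool" where
  "bgr_bound k G H n \<longleftrightarrow>
     n\<^sup>2 \<ge> k \<and>
     (\<forall>N\<ge>n. \<forall>c. exact_edge_coloring k (complete_bipartite N N) c \<longrightarrow>
        (\<exists>F. is_copy G F (complete_bipartite N N) \<and> rainbow c F) \<or>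
        (\<exists>F. is_copy H F (complete_bipartite N N) \<and> monochromatic c F))"

text \<open>
  The infimum is taken in \<^typ>\<open>enat\<close>, so that it is \<open>\<infinity>\<close> if there is no admissible \<open>n\<close>;
  a finite value is thus always an attained minimum.
\<close>

definition bgr :: "nat \<Rightarrow> 'a graph \<Rightarrow> 'b graph \<Rightarrow> enat" where
  "bgr k G H = Inf {enat n | n. bgr_bound k G H n}"

end

theory Submission
  imports Defs
begin

text \<open>
  A rainbow \<open>K\<^bsub>1,3\<^esub>\<close> exists as soon as some vertex sees three colors, so the theorem is about
  colorings of \<open>K\<^bsub>N,N\<^esub>\<close> in which every vertex sees at most two. The color sets of vertices on
  opposite sides then meet, because the edge joining two vertices has a color seen by both, and every
  color occurs on both sides. With at least five colors this rigid situation leaves only stars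
  (\<open>cross_intersecting_common_point\<close>): one color \<open>a\<close> is seen by every vertex. Hence each side splits
  into \<open>k - 1\<close> nonempty classes, one for each other color, such that every edge between
  classes of different names has color \<open>a\<close> (\<open>dominant_color_classes\<close>).

  Upper bound. If \<open>S\<close> is a set of class names, the left vertices with class in \<open>S\<close> and
  the right vertices with class outside \<open>S\<close> span a bipartite graph of color \<open>a\<close>. A copy
  of \<open>K\<^bsub>s,t\<^esub>\<close> is therefore found once the class sizes \<open>f\<close>, \<open>g\<close> on the two sides admit an
  \<open>S\<close> with \<open>f(S) \<ge> s\<close> and \<open>g(S) \<le> N - t\<close>, or the same with \<open>f\<close> and \<open>g\<close> exchanged. That such an
  \<open>S\<close> exists when there are many classes is the purely numerical heart of the proof
  (\<open>balanced_index_set\<close>).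

  Lower bound. On \<open>N = s + t - 1\<close> vertices per side, give both sides the same class sizes, with
  all classes but at most one of size 1, and color the edges inside class \<open>i\<close> with \<open>i\<close>. Since now
  \<open>f = g\<close>, no \<open>S\<close> satisfies \<open>f(S) \<ge> s\<close> and \<open>g(S) \<le> N - t = s - 1\<close>, so color \<open>a\<close> contains
  no \<open>K\<^bsub>s,t\<^esub>\<close>, and the classes are too small to contain one in another color.
\<close>

section \<open>Copies of complete bipartite graphs\<close>

definition biclique :: "nat set \<Rightarrow> nat set \<Rightarrow> (nat + nat) graph" where
  "biclique A B = (Inl ` A \<union> Inr ` B, {{Inl a, Inr b} | a b. a \<in> A \<and> b \<in> B})"

lemma complete_bipartite_eq_biclique: "complete_bipartite m n = biclique {..<m} {..<n}"
  by (simp add: complete_bipartite_def biclique_def)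

lemma image_edges_biclique:
  "G ` edges (biclique A B) = {G {Inl a, Inr b} | a b. a \<in> A \<and> b \<in> B}"
  unfolding biclique_def snd_conv by blast

lemma biclique_is_copy:
  assumes "A \<subseteq> {..<N}" "B \<subseteq> {..<N}"
    and "card A = s \<and> card B = t \<or> card A = t \<and> card B = s"
  shows "is_copy (complete_bipartite s t) (biclique A B) (complete_bipartite N N)"
proof -
  have fin: "finite A" "finite B" using assms finite_subset by blast+
  have sub: "subgraph (biclique A B) (complete_bipartite N N)"
  proof -
    have "simple_graph (biclique A B)"
      unfolding simple_graph_def biclique_def using fin by auto
    moreover have "verts (biclique A B) \<subseteq> verts (complete_bipartite N N)"
      using assms(1,2) by (auto simp: complete_bipartite_eq_biclique biclique_def)
    moreover have "edges (biclique A B) \<subseteq> edges (complete_bipartite N N)"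
    proof
      fix e assume "e \<in> edges (biclique A B)"
      then obtain a b where "e = {Inl a, Inr b}" "a \<in> A" "b \<in> B" by (auto simp: biclique_def)
      moreover from this have "a < N" "b < N" using assms(1,2) by auto
      ultimately show "e \<in> edges (complete_bipartite N N)"
        unfolding complete_bipartite_def by auto
    qed
    ultimately show ?thesis by (simp add: subgraph_def)
  qed
  obtain \<alpha> where \<alpha>: "bij_betw \<alpha> A {..<card A}"
    using ex_bij_betw_finite_nat[OF fin(1)] by (auto simp: atLeast0LessThan)
  obtain \<beta> where \<beta>: "bij_betw \<beta> B {..<card B}"
    using ex_bij_betw_finite_nat[OF fin(2)] by (auto simp: atLeast0LessThan)
  have im: "\<alpha> ` A = {..<card A}" "\<beta> ` B = {..<card B}"
    using \<alpha> \<beta> by (auto simp: bij_betw_def)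
  have inj: "inj_on \<alpha> A" "inj_on \<beta> B"
    using \<alpha> \<beta> by (auto simp: bij_betw_def)
  from assms(3) have "isomorphic (biclique A B) (complete_bipartite s t)"
  proof
    assume c: "card A = s \<and> card B = t"
    let ?f = "case_sum (\<lambda>a. Inl (\<alpha> a)) (\<lambda>b. Inr (\<beta> b)) :: nat + nat \<Rightarrow> nat + nat"
    have "bij_betw ?f (verts (biclique A B)) (verts (complete_bipartite s t))"
      unfolding bij_betw_def
    proof
      show "inj_on ?f (verts (biclique A B))"
        by (auto intro!: inj_onI dest: inj_onD[OF inj(1)] inj_onD[OF inj(2)] simp: biclique_def)
      have "?f ` verts (biclique A B) = Inl ` \<alpha> ` A \<union> Inr ` \<beta> ` B"
        by (simp add: biclique_def image_Un image_image Un_commute)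
      then show "?f ` verts (biclique A B) = verts (complete_bipartite s t)"
        using im c by (simp add: complete_bipartite_def)
    qed
    moreover have "(\<lambda>e. ?f ` e) ` edges (biclique A B) =
        {?f ` {Inl a, Inr b} | a b. a \<in> A \<and> b \<in> B}"
      by (rule image_edges_biclique)
    then have "(\<lambda>e. ?f ` e) ` edges (biclique A B) =
        edges (biclique (\<alpha> ` A) (\<beta> ` B))"
      by (simp add: biclique_def) blast
    then have "(\<lambda>e. ?f ` e) ` edges (biclique A B) = edges (complete_bipartite s t)"
      using im c by (simp add: complete_bipartite_eq_biclique)
    ultimately show ?thesis
      unfolding isomorphic_def by blast
  next
    assume c: "card A = t \<and> card B = s"
    let ?f = "case_sum (\<lambda>a. Inr (\<alpha> a)) (\<lambda>b. Inl (\<beta> b)) :: nat + nat \<Rightarrow> nat + nat"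
    have "bij_betw ?f (verts (biclique A B)) (verts (complete_bipartite s t))"
      unfolding bij_betw_def
    proof
      show "inj_on ?f (verts (biclique A B))"
        by (auto intro!: inj_onI dest: inj_onD[OF inj(1)] inj_onD[OF inj(2)] simp: biclique_def)
      have "?f ` verts (biclique A B) = Inl ` \<beta> ` B \<union> Inr ` \<alpha> ` A"
        by (simp add: biclique_def image_Un image_image Un_commute)
      then show "?f ` verts (biclique A B) = verts (complete_bipartite s t)"
        using im c by (simp add: complete_bipartite_def)
    qed
    moreover have "(\<lambda>e. ?f ` e) ` edges (biclique A B) =
        {?f ` {Inl a, Inr b} | a b. a \<in> A \<and> b \<in> B}"
      by (rule image_edges_biclique)
    then have "(\<lambda>e. ?f ` e) ` edges (biclique A B) =
        edges (biclique (\<beta> ` B) (\<alpha> ` A))"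
      by (simp add: biclique_def insert_commute) blast
    then have "(\<lambda>e. ?f ` e) ` edges (biclique A B) = edges (complete_bipartite s t)"
      using im c by (simp add: complete_bipartite_eq_biclique)
    ultimately show ?thesis
      unfolding isomorphic_def by blast
  qed
  with sub show ?thesis by (simp add: is_copy_def)
qed

text \<open>
  The two parts of a copy lie on opposite sides of the host: a vertex of one part is adjacent to the
  whole other part, which therefore lies on a single side.
\<close>

lemma copy_is_biclique:
  assumes copy: "is_copy (complete_bipartite s t) F (complete_bipartite N N)"
    and pos: "0 < s" "0 < t"
  obtains A B where "A \<subseteq> {..<N}" "B \<subseteq> {..<N}"
    and "card A = s \<and> card B = t \<or> card A = t \<and> card B = s"
    and "edges F = edges (biclique A B)"
proof -
  let ?K = "complete_bipartite s t" and ?H = "complete_bipartite N N"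
  from copy obtain f where f: "bij_betw f (verts F) (verts ?K)"
    and fe: "(\<lambda>e. f ` e) ` edges F = edges ?K"
    by (auto simp: is_copy_def isomorphic_def)
  have FH: "edges F \<subseteq> edges ?H" and F: "\<forall>e\<in>edges F. e \<subseteq> verts F"
    using copy by (auto simp: is_copy_def subgraph_def simple_graph_def)
  define h where "h = inv_into (verts F) f"
  have h: "inj_on h (verts ?K)"
    using bij_betw_inv_into[OF f] by (simp add: h_def bij_betw_def)
  have "h ` (f ` e) = e" if "e \<in> edges F" for e
    using that F f unfolding h_def bij_betw_def by (simp add: inv_into_image_cancel)
  then have "edges F = (\<lambda>e. h ` e) ` (\<lambda>e. f ` e) ` edges F"
    by (auto simp: image_image)
  also have "\<dots> = {{h (Inl i), h (Inr j)} | i j. i < s \<and> j < t}"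
    unfolding fe complete_bipartite_eq_biclique image_edges_biclique by auto
  finally have eF: "edges F = {{h (Inl i), h (Inr j)} | i j. i < s \<and> j < t}" .
  have ed: "\<exists>a b. a < N \<and> b < N \<and> {h (Inl i), h (Inr j)} = {Inl a, Inr b}" if "i < s" "j < t" for i j
  proof -
    have "{h (Inl i), h (Inr j)} \<in> edges ?H" using that FH eF by blast
    then show ?thesis by (auto simp: complete_bipartite_def)
  qed
  have iL: "inj_on (\<lambda>i. h (Inl i)) {..<s}" and iR: "inj_on (\<lambda>j. h (Inr j)) {..<t}"
    by (auto intro!: inj_onI dest!: inj_onD[OF h] simp: complete_bipartite_def)
  show thesis
  proof (cases "h (Inl 0)")
    case (Inl a0)
    have R: "\<exists>b<N. h (Inr j) = Inr b" if "j < t" for j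
      using ed[OF pos(1) that] Inl by (auto simp: doubleton_eq_iff)
    have L: "\<exists>a<N. h (Inl i) = Inl a" if "i < s" for i
      using ed[OF that pos(2)] R[OF pos(2)] by (auto simp: doubleton_eq_iff)
    from L obtain \<alpha> where \<alpha>: "\<And>i. i < s \<Longrightarrow> \<alpha> i < N \<and> h (Inl i) = Inl (\<alpha> i)" by metis
    from R obtain \<beta> where \<beta>: "\<And>j. j < t \<Longrightarrow> \<beta> j < N \<and> h (Inr j) = Inr (\<beta> j)" by metis
    have "inj_on \<alpha> {..<s}" "inj_on \<beta> {..<t}"
      using iL iR \<alpha> \<beta> by (auto simp: inj_on_def)
    then have "card (\<alpha> ` {..<s}) = s" "card (\<beta> ` {..<t}) = t" by (simp_all add: card_image)
    moreover have "edges F = {{Inl (\<alpha> i), Inr (\<beta> j)} | i j. i < s \<and> j < t}"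
      unfolding eF by (intro Collect_cong ex_cong1) (auto simp: \<alpha> \<beta>)
    then have "edges F = edges (biclique (\<alpha> ` {..<s}) (\<beta> ` {..<t}))"
      by (simp add: biclique_def) blast
    ultimately show thesis
      using that[of "\<alpha> ` {..<s}" "\<beta> ` {..<t}"] \<alpha> \<beta> by auto
  next
    case (Inr a0)
    have R: "\<exists>b<N. h (Inr j) = Inl b" if "j < t" for j
      using ed[OF pos(1) that] Inr by (auto simp: doubleton_eq_iff)
    have L: "\<exists>a<N. h (Inl i) = Inr a" if "i < s" for i
      using ed[OF that pos(2)] R[OF pos(2)] by (auto simp: doubleton_eq_iff)
    from L obtain \<alpha> where \<alpha>: "\<And>i. i < s \<Longrightarrow> \<alpha> i < N \<and> h (Inl i) = Inr (\<alpha> i)" by metis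
    from R obtain \<beta> where \<beta>: "\<And>j. j < t \<Longrightarrow> \<beta> j < N \<and> h (Inr j) = Inl (\<beta> j)" by metis
    have "inj_on \<alpha> {..<s}" "inj_on \<beta> {..<t}"
      using iL iR \<alpha> \<beta> by (auto simp: inj_on_def)
    then have "card (\<alpha> ` {..<s}) = s" "card (\<beta> ` {..<t}) = t" by (simp_all add: card_image)
    moreover have "edges F = {{Inl (\<beta> j), Inr (\<alpha> i)} | i j. i < s \<and> j < t}"
      unfolding eF by (intro Collect_cong ex_cong1) (auto simp: \<alpha> \<beta> insert_commute)
    then have "edges F = edges (biclique (\<beta> ` {..<t}) (\<alpha> ` {..<s}))"
      by (simp add: biclique_def) blast
    ultimately show thesis
      using that[of "\<beta> ` {..<t}" "\<alpha> ` {..<s}"] \<alpha> \<beta> by auto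
  qed
qed

lemma rainbow_star_iff:
  "(\<exists>F. is_copy (complete_bipartite 1 3) F (complete_bipartite N N) \<and> rainbow c F) \<longleftrightarrow>
     (\<exists>x<N. 3 \<le> card ((\<lambda>y. c {Inl x, Inr y}) ` {..<N})) \<or>
     (\<exists>y<N. 3 \<le> card ((\<lambda>x. c {Inl x, Inr y}) ` {..<N}))"
  (is "?L \<longleftrightarrow> ?R1 \<or> ?R2")
proof
  assume ?L
  then obtain F where F: "is_copy (complete_bipartite 1 3) F (complete_bipartite N N)" "rainbow c F"
    by blast
  from copy_is_biclique[OF F(1)] obtain A B where AB: "A \<subseteq> {..<N}" "B \<subseteq> {..<N}"
    and card: "card A = 1 \<and> card B = 3 \<or> card A = 3 \<and> card B = 1"
    and e: "edges F = edges (biclique A B)" by auto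
  have inj: "inj_on c {{Inl a, Inr b} | a b. a \<in> A \<and> b \<in> B}"
    using F(2) e by (simp add: rainbow_def biclique_def)
  from card show "?R1 \<or> ?R2"
  proof
    assume c: "card A = 1 \<and> card B = 3"
    then obtain x where x: "A = {x}" by (meson card_1_singletonE)
    have "inj_on (\<lambda>y. c {Inl x, Inr y}) B"
      by (auto intro!: inj_onI dest!: inj_onD[OF inj] simp: x doubleton_eq_iff)
    then have "card ((\<lambda>y. c {Inl x, Inr y}) ` B) = 3" using c by (simp add: card_image)
    moreover have "card ((\<lambda>y. c {Inl x, Inr y}) ` B) \<le> card ((\<lambda>y. c {Inl x, Inr y}) ` {..<N})"
      using AB by (intro card_mono) auto
    ultimately show ?thesis using AB x by auto
  next
    assume c: "card A = 3 \<and> card B = 1"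
    then obtain y where y: "B = {y}" by (meson card_1_singletonE)
    have "inj_on (\<lambda>x. c {Inl x, Inr y}) A"
      by (auto intro!: inj_onI dest!: inj_onD[OF inj] simp: y doubleton_eq_iff)
    then have "card ((\<lambda>x. c {Inl x, Inr y}) ` A) = 3" using c by (simp add: card_image)
    moreover have "card ((\<lambda>x. c {Inl x, Inr y}) ` A) \<le> card ((\<lambda>x. c {Inl x, Inr y}) ` {..<N})"
      using AB by (intro card_mono) auto
    ultimately show ?thesis using AB y by auto
  qed
next
  have pick: "\<exists>B\<subseteq>{..<N}. card B = 3 \<and> inj_on g B" if big: "3 \<le> card (g ` {..<N})" for g :: "nat \<Rightarrow> nat"
  proof -
    obtain C where C: "C \<subseteq> g ` {..<N}" "card C = 3"
      using obtain_subset_with_card_n[OF big] by blast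
    then obtain B where "B \<subseteq> {..<N}" "C = g ` B" "inj_on g B"
      by (meson subset_image_inj)
    then show ?thesis using C by (metis card_image)
  qed
  assume "?R1 \<or> ?R2"
  then show ?L
  proof
    assume ?R1
    then obtain x B where x: "x < N" and B: "B \<subseteq> {..<N}" "card B = 3"
      and inj: "inj_on (\<lambda>y. c {Inl x, Inr y}) B"
      using pick by metis
    have "is_copy (complete_bipartite 1 3) (biclique {x} B) (complete_bipartite N N)"
      using biclique_is_copy[of "{x}" N B] x B by auto
    moreover have "rainbow c (biclique {x} B)"
      by (auto simp: rainbow_def biclique_def intro!: inj_onI dest!: inj_onD[OF inj])
    ultimately show ?L by blast
  next
    assume ?R2
    then obtain y A where y: "y < N" and A: "A \<subseteq> {..<N}" "card A = 3"
      and inj: "inj_on (\<lambda>x. c {Inl x, Inr y}) A"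
      using pick by metis
    have "is_copy (complete_bipartite 1 3) (biclique A {y}) (complete_bipartite N N)"
      using biclique_is_copy[of A N "{y}"] y A by auto
    moreover have "rainbow c (biclique A {y})"
      by (auto simp: rainbow_def biclique_def intro!: inj_onI dest!: inj_onD[OF inj])
    ultimately show ?L by blast
  qed
qed

section \<open>Colorings in which every vertex sees at most two colors\<close>

lemma three_points_not_in_card_2:
  assumes "finite T" "card T \<le> 2" "x \<in> T" "y \<in> T" "z \<in> T"
  shows "x = y \<or> y = z \<or> x = z"
proof (rule ccontr)
  assume "\<not> ?thesis"
  then have "card {x, y, z} = 3" by auto
  moreover have "card {x, y, z} \<le> card T" using assms by (intro card_mono) auto
  ultimately show False using assms(2) by simp
qed

text \<open>
  Two disjoint members of \<open>\<D>\<close> would leave a fifth point free, and the member of \<open>\<C>\<close> through that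
  point would need a third element to meet both. So \<open>\<D>\<close> is intersecting, hence a triangle or a star,
  and a triangle covers three points only. A member of \<open>\<C>\<close> avoiding the center of the star
  would miss the member of \<open>\<D>\<close> that joins the center to a point not in that member of \<open>\<C>\<close>.
\<close>

lemma cross_intersecting_common_point:
  fixes \<C> \<D> :: "'a set set"
  assumes fin: "\<And>P. P \<in> \<C> \<union> \<D> \<Longrightarrow> finite P \<and> card P \<le> 2"
    and cross: "\<And>P Q. P \<in> \<C> \<Longrightarrow> Q \<in> \<D> \<Longrightarrow> P \<inter> Q \<noteq> {}"
    and UC: "\<Union>\<C> = K" and UD: "\<Union>\<D> = K" and K: "5 \<le> card K"
  shows "\<exists>a\<in>K. \<forall>P\<in>\<C> \<union> \<D>. a \<in> P"
proof -
  have free: "\<exists>e\<in>K. e \<notin> M" if "finite M" "card M < 5" for M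
    using that K by (metis card_mono not_less order_less_le_trans subsetI)
  have inter: "P \<inter> Q \<noteq> {}" if P: "P \<in> \<D>" and Q: "Q \<in> \<D>" for P Q
  proof
    assume PQ: "P \<inter> Q = {}"
    have "finite (P \<union> Q)" "card (P \<union> Q) < 5"
      using fin[of P] fin[of Q] P Q card_Un_le[of P Q] by auto
    then obtain e where e: "e \<in> K" "e \<notin> P \<union> Q" using free by blast
    then obtain R where R: "R \<in> \<C>" "e \<in> R" using UC by auto
    obtain u v where "u \<in> R \<inter> P" "v \<in> R \<inter> Q" using cross R P Q by blast
    then show False
      using three_points_not_in_card_2[of R e u v] fin[of R] R e PQ by auto
  qed
  have "\<exists>a. \<forall>P\<in>\<D>. a \<in> P"
  proof (rule ccontr)
    assume no: "\<not> ?thesis"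
    have "K \<noteq> {}" using K by auto
    then obtain P a where P: "P \<in> \<D>" "a \<in> P" using UD by blast
    obtain Q where Q: "Q \<in> \<D>" "a \<notin> Q" using no by blast
    obtain b where b: "b \<in> P" "b \<in> Q" using inter P Q by blast
    obtain R where R: "R \<in> \<D>" "b \<notin> R" using no by blast
    obtain c where c: "c \<in> Q" "c \<in> R" using inter Q R by blast
    have aR: "a \<in> R"
      using inter[OF P(1) R(1)] three_points_not_in_card_2[of P a b] fin[of P] P b R Q by blast
    have "card {a, b, c} < 5" by (simp add: card_insert_if)
    then obtain e where e: "e \<in> K" "e \<notin> {a, b, c}" using free[of "{a, b, c}"] by auto
    then obtain T where T: "T \<in> \<D>" "e \<in> T" using UD by auto
    have pair: "\<And>M x y z. M \<in> \<D> \<Longrightarrow> x \<in> M \<Longrightarrow> y \<in> M \<Longrightarrow> z \<in> M \<Longrightarrow> x = y \<or> y = z \<or> x = z"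
      using three_points_not_in_card_2 fin by (metis UnI2)
    have abc: "a \<noteq> b" "b \<noteq> c" "a \<noteq> c" using b c R Q by auto
    have "a \<in> T \<or> b \<in> T"
      using inter[OF T(1) P(1)] pair[OF P(1) P(2) b(1)] abc by blast
    moreover have "b \<in> T \<or> c \<in> T"
      using inter[OF T(1) Q(1)] pair[OF Q(1) b(2) c(1)] abc by blast
    moreover have "a \<in> T \<or> c \<in> T"
      using inter[OF T(1) R(1)] pair[OF R(1) aR c(2)] abc by blast
    ultimately show False
      using pair[OF T(1) T(2)] abc e(2) by (metis insertCI)
  qed
  then obtain a where a: "\<And>P. P \<in> \<D> \<Longrightarrow> a \<in> P" by blast
  have "a \<in> P" if P: "P \<in> \<C>" for P
  proof (rule ccontr)
    assume aP: "a \<notin> P"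
    have "finite (insert a P)" "card (insert a P) < 5"
      using fin[of P] P by (auto simp: card_insert_if)
    then obtain v where v: "v \<in> K" "v \<notin> insert a P" using free by blast
    then obtain Q where Q: "Q \<in> \<D>" "v \<in> Q" using UD by auto
    obtain u where "u \<in> P" "u \<in> Q" using cross[OF P Q(1)] by blast
    then show False
      using three_points_not_in_card_2[of Q u v a] fin[of Q] a[OF Q(1)] Q v aP by auto
  qed
  moreover have "a \<in> K"
  proof -
    have "K \<noteq> {}" using K by auto
    then show ?thesis using UD a by blast
  qed
  ultimately show ?thesis using a by blast
qed

text \<open>
  Once every vertex sees \<open>a\<close>, its class is the other color that it sees, and vertices of
  different classes have only \<open>a\<close> in common. A vertex that sees only the dominant color \<open>a\<close> may be put into any class.
\<close>

lemma dominant_color_classes: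
  fixes d :: "nat \<Rightarrow> nat \<Rightarrow> nat"
  assumes row: "\<And>x. x < N \<Longrightarrow> card ((\<lambda>y. d x y) ` {..<N}) \<le> 2"
    and col: "\<And>y. y < N \<Longrightarrow> card ((\<lambda>x. d x y) ` {..<N}) \<le> 2"
    and onto: "{d x y | x y. x < N \<and> y < N} = {..<k}" and k: "5 \<le> k"
  obtains a p q where "a < k"
    and "p ` {..<N} = {..<k} - {a}" and "q ` {..<N} = {..<k} - {a}"
    and "\<And>x y. x < N \<Longrightarrow> y < N \<Longrightarrow> p x \<noteq> q y \<Longrightarrow> d x y = a"
proof -
  define C where "C x = (\<lambda>y. d x y) ` {..<N}" for x
  define D where "D y = (\<lambda>x. d x y) ` {..<N}" for y
  have U: "\<Union>(C ` {..<N}) = {..<k}" "\<Union>(D ` {..<N}) = {..<k}"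
    using onto unfolding C_def D_def by blast+
  have "\<exists>a\<in>{..<k}. \<forall>P\<in>C ` {..<N} \<union> D ` {..<N}. a \<in> P"
  proof (rule cross_intersecting_common_point[OF _ _ U])
    show "finite P \<and> card P \<le> 2" if "P \<in> C ` {..<N} \<union> D ` {..<N}" for P
      using that row col by (auto simp: C_def D_def)
    show "P \<inter> Q \<noteq> {}" if "P \<in> C ` {..<N}" "Q \<in> D ` {..<N}" for P Q
      using that by (force simp: C_def D_def)
  qed (use k in simp)
  then obtain a where a: "a < k" "\<And>x. x < N \<Longrightarrow> a \<in> C x" "\<And>y. y < N \<Longrightarrow> a \<in> D y"
    by auto
  have other: "\<exists>u. u \<in> {..<k} - {a} \<and> M \<subseteq> {a, u}"
    if M: "finite M" "card M \<le> 2" "a \<in> M" "M \<subseteq> {..<k}" for M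
  proof (cases "M = {a}")
    case True
    moreover have "(if a = 0 then 1 else 0) \<in> {..<k} - {a}" using k by auto
    ultimately show ?thesis by blast
  next
    case False
    then obtain u where u: "u \<in> M" "u \<noteq> a" using M by blast
    then have "M \<subseteq> {a, u}" using three_points_not_in_card_2[OF M(1,2,3) u(1)] by auto
    then show ?thesis using u M by blast
  qed
  have "\<exists>u. u \<in> {..<k} - {a} \<and> C x \<subseteq> {a, u}" if "x < N" for x
    using other[of "C x"] row[OF that] a(2)[OF that] U(1) that by (auto simp: C_def)
  then obtain p where p: "\<And>x. x < N \<Longrightarrow> p x \<in> {..<k} - {a} \<and> C x \<subseteq> {a, p x}" by metis
  have "\<exists>u. u \<in> {..<k} - {a} \<and> D y \<subseteq> {a, u}" if "y < N" for y
    using other[of "D y"] col[OF that] a(3)[OF that] U(2) that by (auto simp: D_def)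
  then obtain q where q: "\<And>y. y < N \<Longrightarrow> q y \<in> {..<k} - {a} \<and> D y \<subseteq> {a, q y}" by metis
  show thesis
  proof (rule that[OF a(1)])
    have "i \<in> p ` {..<N}" if "i \<in> {..<k} - {a}" for i
    proof -
      have "i \<in> \<Union>(C ` {..<N})" using that U(1) by blast
      then obtain x where "x < N" "i \<in> C x" by blast
      then show ?thesis using p[of x] that by blast
    qed
    then show "p ` {..<N} = {..<k} - {a}" using p by blast
    have "i \<in> q ` {..<N}" if "i \<in> {..<k} - {a}" for i
    proof -
      have "i \<in> \<Union>(D ` {..<N})" using that U(2) by blast
      then obtain x where "x < N" "i \<in> D x" by blast
      then show ?thesis using q[of x] that by blast
    qed
    then show "q ` {..<N} = {..<k} - {a}" using q by blast
    show "d x y = a" if "x < N" "y < N" "p x \<noteq> q y" for x y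
    proof -
      have "d x y \<in> C x" "d x y \<in> D y" using that by (auto simp: C_def D_def)
      then have "d x y \<in> {a, p x}" "d x y \<in> {a, q y}" using p[OF that(1)] q[OF that(2)] by blast+
      then show ?thesis using that(3) by auto
    qed
  qed
qed

section \<open>Selecting classes with balanced sizes\<close>

text \<open>
  When a set is built up one index at a time until \<open>f\<close> or \<open>g\<close> reaches \<open>s\<close>, the last
  step increases one of the two sums by at most \<open>r + 1\<close>, from at most \<open>s - 1\<close>.
\<close>

lemma greedy_index_set:
  fixes f g :: "'i \<Rightarrow> nat"
  assumes "finite A" and small: "\<And>i. i \<in> A \<Longrightarrow> f i \<le> r + 1 \<or> g i \<le> r + 1"
    and "s \<le> sum f A \<or> s \<le> sum g A" and "0 < s"
  shows "\<exists>S\<subseteq>A. s \<le> sum f S \<and> sum g S \<le> s + r \<or> s \<le> sum g S \<and> sum f S \<le> s + r"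
  using assms(1-3)
proof (induction A rule: finite_induct)
  case empty
  then show ?case using \<open>0 < s\<close> by simp
next
  case (insert i A)
  show ?case
  proof (cases "s \<le> sum f A \<or> s \<le> sum g A")
    case True
    then obtain S where "S \<subseteq> A"
      "s \<le> sum f S \<and> sum g S \<le> s + r \<or> s \<le> sum g S \<and> sum f S \<le> s + r"
      using insert by blast
    then show ?thesis by blast
  next
    case False
    moreover have "f i \<le> r + 1 \<or> g i \<le> r + 1" using insert by blast
    ultimately have "s \<le> sum f (insert i A) \<and> sum g (insert i A) \<le> s + r \<or>
        s \<le> sum g (insert i A) \<and> sum f (insert i A) \<le> s + r"
      using insert.hyps insert.prems(2) by auto
    then show ?thesis by blast
  qed
qed

text \<open>
  Let \<open>r = N - s - t\<close> and let \<open>A\<close> collect the indices with \<open>f\<close> or \<open>g\<close> at most \<open>r + 1\<close>. If the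
  greedy choice inside \<open>A\<close> fails, then \<open>A\<close> has fewer than \<open>s\<close> elements, so at least
  \<open>\<lceil>t / 2\<rceil> \<ge> 3\<close> indices have both values at least \<open>r + 2\<close>. The sums over all of \<open>I\<close> would then
  exceed \<open>N\<close> unless \<open>r = 0\<close>, and for \<open>r = 0\<close> the values of \<open>f\<close> on these indices exceed 2 by at
  most 1 in total, and likewise those of \<open>g\<close>. So one of these indices, say \<open>i\<close>, has \<open>f i = g i = 2\<close>, and both sums over \<open>A\<close> lie
  in \<open>{s - 2, s - 1}\<close>. Adding \<open>i\<close> to \<open>A\<close> works if one of the sums is \<open>s - 2\<close>; otherwise the values
  on \<open>A\<close> are all 1, and one element of \<open>A\<close> is exchanged for \<open>i\<close>.
\<close>

lemma balanced_index_set: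
  fixes f g :: "'i \<Rightarrow> nat"
  assumes fin: "finite I" and pos: "\<And>i. i \<in> I \<Longrightarrow> 1 \<le> f i \<and> 1 \<le> g i"
    and sf: "sum f I = N" and sg: "sum g I = N" and N: "s + t \<le> N"
    and s: "2 \<le> s" and t: "5 \<le> t" and card: "s + t \<le> card I + t div 2 + 1"
  shows "\<exists>S\<subseteq>I. s \<le> sum f S \<and> sum g S + t \<le> N \<or> s \<le> sum g S \<and> sum f S + t \<le> N"
proof -
  define r where "r = N - s - t"
  have Nr: "N = s + t + r" using N by (simp add: r_def)
  define A where "A = {i \<in> I. f i \<le> r + 1 \<or> g i \<le> r + 1}"
  define B where "B = I - A"
  have fA: "finite A" and fB: "finite B" and AI: "A \<subseteq> I" using fin by (auto simp: A_def B_def)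
  have B2: "r + 2 \<le> f i \<and> r + 2 \<le> g i" if "i \<in> B" for i
    using that by (auto simp: A_def B_def)
  have cI: "card I = card A + card B"
    using fin AI by (simp add: B_def card_Diff_subset fA card_mono)
  have splitf: "sum f A + sum f B = N" and splitg: "sum g A + sum g B = N"
    using sum.subset_diff[OF AI fin, of f] sum.subset_diff[OF AI fin, of g] sf sg
    by (simp_all add: B_def)
  show ?thesis
  proof (cases "s \<le> sum f A \<or> s \<le> sum g A")
    case True
    then obtain S where "S \<subseteq> A"
      "s \<le> sum f S \<and> sum g S \<le> s + r \<or> s \<le> sum g S \<and> sum f S \<le> s + r"
      using greedy_index_set[OF fA, of f r g s] s by (auto simp: A_def)
    then show ?thesis using AI Nr by (intro exI[of _ S]) auto
  next
    case False
    have Af: "card A \<le> sum f A" and Ag: "card A \<le> sum g A"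
      using sum_mono[of A "\<lambda>_. 1" f] sum_mono[of A "\<lambda>_. 1" g] pos AI by auto
    have excess: "sum h B = sum (\<lambda>i. h i - (r + 2)) B + card B * (r + 2)"
      if "\<And>i. i \<in> B \<Longrightarrow> r + 2 \<le> h i" for h
    proof -
      have "sum h B = sum (\<lambda>i. (h i - (r + 2)) + (r + 2)) B"
        using that by (intro sum.cong) (simp_all del: add_2_eq_Suc')
      then show ?thesis unfolding sum.distrib by simp
    qed
    have Bf: "sum f B = sum (\<lambda>i. f i - (r + 2)) B + card B * (r + 2)"
      and Bg: "sum g B = sum (\<lambda>i. g i - (r + 2)) B + card B * (r + 2)"
      using excess B2 by blast+
    have B3: "t \<le> card B + t div 2" using card cI False Af by linarith
    then have "3 \<le> card B" using t by linarith
    have "r = 0"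
    proof (rule ccontr)
      assume "r \<noteq> 0"
      have "3 * r \<le> card B * r" using \<open>3 \<le> card B\<close> by simp
      moreover have "2 * card B + card B * r + sum f A \<le> s + t + r"
        using Bf splitf Nr by (simp add: algebra_simps)
      ultimately show False using \<open>r \<noteq> 0\<close> card cI False Af by linarith
    qed
    have Bf: "sum f B = sum (\<lambda>i. f i - 2) B + 2 * card B"
      and Bg: "sum g B = sum (\<lambda>i. g i - 2) B + 2 * card B"
      using Bf Bg \<open>r = 0\<close> by (simp_all add: numeral_2_eq_2)
    have ef: "sum (\<lambda>i. f i - 2) B \<le> 1"
      using Bf splitf Nr \<open>r = 0\<close> card cI False Af by linarith
    have eg: "sum (\<lambda>i. g i - 2) B \<le> 1"
      using Bg splitg Nr \<open>r = 0\<close> card cI False Ag by linarith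
    have "\<exists>i\<in>B. f i = 2 \<and> g i = 2"
    proof (rule ccontr)
      assume "\<not> ?thesis"
      then have "1 \<le> (f i - 2) + (g i - 2)" if "i \<in> B" for i
        using that B2[OF that] \<open>r = 0\<close> by force
      then have "card B \<le> sum (\<lambda>i. (f i - 2) + (g i - 2)) B"
        using sum_mono[of B "\<lambda>_. 1" "\<lambda>i. (f i - 2) + (g i - 2)"] by simp
      then show False using ef eg \<open>3 \<le> card B\<close> by (simp add: sum.distrib)
    qed
    then obtain i where i: "i \<in> B" "f i = 2" "g i = 2" by blast
    have iA: "i \<notin> A" "i \<in> I" using i by (auto simp: B_def)
    have lower: "s \<le> card A + 2" using Bf splitf Nr \<open>r = 0\<close> card cI Af by linarith
    show ?thesis
    proof (cases "sum f A + 2 = s \<or> sum g A + 2 = s")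
      case True
      have "sum f (insert i A) = sum f A + 2" "sum g (insert i A) = sum g A + 2"
        using iA fA i by auto
      then show ?thesis
        using True lower Af Ag Nr \<open>r = 0\<close> iA AI by (intro exI[of _ "insert i A"]) auto
    next
      case neq: False
      have eqf: "sum f A = s - 1" and eqg: "sum g A = s - 1"
        using neq False lower Af Ag by auto
      have cA: "card A = s - 1"
        using Bf splitf Nr \<open>r = 0\<close> card cI Af eqf s by linarith
      then obtain j where j: "j \<in> A" using s by fastforce
      have rest: "card (A - {j}) \<le> sum f (A - {j})" "card (A - {j}) \<le> sum g (A - {j})"
        using sum_mono[of "A - {j}" "\<lambda>_. 1" f] sum_mono[of "A - {j}" "\<lambda>_. 1" g] pos AI by auto
      have "1 \<le> f j" "1 \<le> g j" using pos j AI by auto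
      then have "sum f (A - {j}) = s - 2" "sum g (A - {j}) = s - 2"
        using rest eqf eqg cA j fA sum.remove[OF fA j, of f] sum.remove[OF fA j, of g] by auto
      then have "sum f (insert i (A - {j})) = s" "sum g (insert i (A - {j})) = s"
        using iA fA i s by auto
      then show ?thesis
        using Nr iA AI by (intro exI[of _ "insert i (A - {j})"]) auto
    qed
  qed
qed

section \<open>The upper bound\<close>

lemma monochromatic_biclique_exists:
  assumes s: "2 \<le> s" and t: "5 \<le> t" and k: "t + s - t div 2 \<le> k" and N: "t + s \<le> N"
    and exact: "exact_edge_coloring k (complete_bipartite N N) c"
    and norainbow: "\<not> (\<exists>F. is_copy (complete_bipartite 1 3) F (complete_bipartite N N) \<and> rainbow c F)"
  shows "\<exists>F. is_copy (complete_bipartite s t) F (complete_bipartite N N) \<and> monochromatic c F"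
proof -
  have onto: "{c {Inl x, Inr y} | x y. x < N \<and> y < N} = {..<k}"
    using exact by (simp add: exact_edge_coloring_def complete_bipartite_eq_biclique image_edges_biclique)
  have "5 \<le> k" using s t k by linarith
  obtain a p q where a: "a < k"
    and p: "p ` {..<N} = {..<k} - {a}" and q: "q ` {..<N} = {..<k} - {a}"
    and d: "\<And>x y. x < N \<Longrightarrow> y < N \<Longrightarrow> p x \<noteq> q y \<Longrightarrow> c {Inl x, Inr y} = a"
  proof (rule dominant_color_classes[of N "\<lambda>x y. c {Inl x, Inr y}" k])
    show "card ((\<lambda>y. c {Inl x, Inr y}) ` {..<N}) \<le> 2" if "x < N" for x
      using norainbow that unfolding rainbow_star_iff by (metis not_less_eq_eq numeral_2_eq_2 numeral_3_eq_3)
    show "card ((\<lambda>x. c {Inl x, Inr y}) ` {..<N}) \<le> 2" if "y < N" for y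
      using norainbow that unfolding rainbow_star_iff by (metis not_less_eq_eq numeral_2_eq_2 numeral_3_eq_3)
  qed (use onto \<open>5 \<le> k\<close> in auto)
  define I where "I = {..<k} - {a}"
  define X where "X S = {x. x < N \<and> p x \<in> S}" for S
  define Y where "Y S = {y. y < N \<and> q y \<in> S}" for S
  have XS: "(\<Sum>i\<in>S. card (X {i})) = card (X S)" and YS: "(\<Sum>i\<in>S. card (Y {i})) = card (Y S)"
    if "finite S" for S
  proof -
    have "X S = (\<Union>i\<in>S. X {i})" "Y S = (\<Union>i\<in>S. Y {i})" by (auto simp: X_def Y_def)
    moreover have "card (\<Union>i\<in>S. X {i}) = (\<Sum>i\<in>S. card (X {i}))"
      "card (\<Union>i\<in>S. Y {i}) = (\<Sum>i\<in>S. card (Y {i}))"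
      using that by (intro card_UN_disjoint; auto simp: X_def Y_def)+
    ultimately show "(\<Sum>i\<in>S. card (X {i})) = card (X S)" "(\<Sum>i\<in>S. card (Y {i})) = card (Y S)"
      by simp_all
  qed
  have XI: "X I = {..<N}" and YI: "Y I = {..<N}" using p q by (auto simp: X_def Y_def I_def)
  have fI: "finite I" and cI: "card I = k - 1" using a by (auto simp: I_def)
  have "\<exists>S\<subseteq>I. s \<le> (\<Sum>i\<in>S. card (X {i})) \<and> (\<Sum>i\<in>S. card (Y {i})) + t \<le> N \<or>
      s \<le> (\<Sum>i\<in>S. card (Y {i})) \<and> (\<Sum>i\<in>S. card (X {i})) + t \<le> N"
  proof (rule balanced_index_set[OF fI])
    show "1 \<le> card (X {i}) \<and> 1 \<le> card (Y {i})" if "i \<in> I" for i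
    proof -
      have "i \<in> p ` {..<N}" "i \<in> q ` {..<N}" using that p q by (auto simp: I_def)
      then have "X {i} \<noteq> {}" "Y {i} \<noteq> {}" by (auto simp: X_def Y_def)
      moreover have "finite (X {i})" "finite (Y {i})" by (auto simp: X_def Y_def)
      ultimately show ?thesis by (simp add: Suc_leI card_gt_0_iff)
    qed
    show "s + t \<le> card I + t div 2 + 1" using cI k \<open>5 \<le> k\<close> by linarith
  qed (use XS[OF fI] YS[OF fI] XI YI N s t in auto)
  then obtain S where S: "S \<subseteq> I"
    and bal': "s \<le> (\<Sum>i\<in>S. card (X {i})) \<and> (\<Sum>i\<in>S. card (Y {i})) + t \<le> N \<or>
      s \<le> (\<Sum>i\<in>S. card (Y {i})) \<and> (\<Sum>i\<in>S. card (X {i})) + t \<le> N" by metis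
  have "finite S" using S fI by (rule finite_subset)
  from bal' have bal: "s \<le> card (X S) \<and> card (Y S) + t \<le> N \<or> s \<le> card (Y S) \<and> card (X S) + t \<le> N"
    unfolding XS[OF \<open>finite S\<close>] YS[OF \<open>finite S\<close>] .
  have compl: "card (X (- S)) + card (X S) = N" "card (Y (- S)) + card (Y S) = N"
  proof -
    have "X (- S) \<union> X S = {..<N}" "X (- S) \<inter> X S = {}" "Y (- S) \<union> Y S = {..<N}" "Y (- S) \<inter> Y S = {}"
      by (auto simp: X_def Y_def)
    moreover have "finite (X M)" "finite (Y M)" for M by (auto simp: X_def Y_def)
    ultimately show "card (X (- S)) + card (X S) = N" "card (Y (- S)) + card (Y S) = N"
      by (metis card_Un_disjoint card_lessThan)+
  qed
  have build: ?thesis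
    if "A \<subseteq> X M" "B \<subseteq> Y (- M)" "card A = s \<and> card B = t \<or> card A = t \<and> card B = s" for A B M
  proof (intro exI conjI)
    show "is_copy (complete_bipartite s t) (biclique A B) (complete_bipartite N N)"
      using that by (intro biclique_is_copy) (auto simp: X_def Y_def)
    have "c e = a" if "e \<in> edges (biclique A B)" for e
      using that \<open>A \<subseteq> X M\<close> \<open>B \<subseteq> Y (- M)\<close> unfolding biclique_def X_def Y_def
      by (fastforce intro!: d)
    then show "monochromatic c (biclique A B)" by (simp add: monochromatic_def)
  qed
  from bal show ?thesis
  proof
    assume "s \<le> card (X S) \<and> card (Y S) + t \<le> N"
    then obtain A B where "A \<subseteq> X S" "card A = s" "B \<subseteq> Y (- S)" "card B = t"
      using compl obtain_subset_with_card_n[of s "X S"] obtain_subset_with_card_n[of t "Y (- S)"]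
      by (metis add.commute add_le_imp_le_right)
    then show ?thesis using build by blast
  next
    assume "s \<le> card (Y S) \<and> card (X S) + t \<le> N"
    then obtain A B where "A \<subseteq> X (- S)" "card A = t" "B \<subseteq> Y S" "card B = s"
      using compl obtain_subset_with_card_n[of s "Y S"] obtain_subset_with_card_n[of t "X (- S)"]
      by (metis add.commute add_le_imp_le_right)
    then show ?thesis using build[of A "- S" B] by auto
  qed
qed

section \<open>The extremal coloring\<close>

text \<open>
  The class of a vertex \<open>x\<close> is \<open>min x m\<close>, on both sides, so the classes are singletons except for the
  last, which has \<open>N - m\<close> vertices. Edges inside class \<open>i\<close> have color \<open>i\<close>, all others have
  color \<open>m + 1\<close>. Because both sides have the same class sizes, parts \<open>A\<close> and \<open>B\<close> of a complete
  bipartite graph of color \<open>m + 1\<close> satisfy \<open>|A| + |B| \<le> N\<close>.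
\<close>

lemma extremal_coloring:
  assumes s: "0 < s" and m: "0 < m" "m < N" and N: "N < s + t" and cls: "N - m < t" "2 \<le> t"
  obtains c where "exact_edge_coloring (m + 2) (complete_bipartite N N) c"
    and "\<not> (\<exists>F. is_copy (complete_bipartite 1 3) F (complete_bipartite N N) \<and> rainbow c F)"
    and "\<not> (\<exists>F. is_copy (complete_bipartite s t) F (complete_bipartite N N) \<and> monochromatic c F)"
proof -
  define cl where "cl x = min x m" for x
  define d where "d x y = (if cl x = cl y then cl x else m + 1)" for x y
  define c :: "(nat + nat) set \<Rightarrow> nat" where
    "c e = d (THE x. Inl x \<in> e) (THE y. Inr y \<in> e)" for e
  have c [simp]: "c {Inl x, Inr y} = d x y" for x y
    by (simp add: c_def)
  have "c ` edges (complete_bipartite N N) = {d x y | x y. x < N \<and> y < N}"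
    by (simp add: complete_bipartite_eq_biclique image_edges_biclique)
  also have "\<dots> = {..<m + 2}"
  proof (intro equalityI subsetI)
    fix i assume "i \<in> {..<m + 2}"
    then consider "i \<le> m" | "i = m + 1" by fastforce
    then show "i \<in> {d x y | x y. x < N \<and> y < N}"
    proof cases
      case 1
      then have "i = d i i" "i < N" using m by (auto simp: d_def cl_def)
      then show ?thesis by blast
    next
      case 2
      then have "i = d 0 1" "0 < N" "1 < N" using m by (auto simp: d_def cl_def)
      then show ?thesis by blast
    qed
  qed (auto simp: d_def cl_def)
  finally have exact: "exact_edge_coloring (m + 2) (complete_bipartite N N) c"
    by (simp add: exact_edge_coloring_def)
  have two: "card M < 3" if "M \<subseteq> {cl x, m + 1}" for M x
  proof -
    have "card M \<le> card {cl x, m + 1}" using that by (intro card_mono) auto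
    also have "\<dots> \<le> 2" by (simp add: card_insert_if)
    finally show ?thesis by simp
  qed
  have norainbow: "\<not> (\<exists>F. is_copy (complete_bipartite 1 3) F (complete_bipartite N N) \<and> rainbow c F)"
  proof -
    have "card ((\<lambda>y. c {Inl x, Inr y}) ` {..<N}) < 3" for x
      by (rule two[of _ x]) (auto simp: d_def)
    moreover have "card ((\<lambda>x. c {Inl x, Inr y}) ` {..<N}) < 3" for y
      by (rule two[of _ y]) (auto simp: d_def)
    ultimately show ?thesis unfolding rainbow_star_iff by (meson not_less)
  qed
  have nomono: False
    if copy: "is_copy (complete_bipartite s t) F (complete_bipartite N N)"
      and mono: "monochromatic c F" for F
  proof -
    obtain A B where AB: "A \<subseteq> {..<N}" "B \<subseteq> {..<N}"
      and card: "card A = s \<and> card B = t \<or> card A = t \<and> card B = s"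
      and e: "edges F = edges (biclique A B)"
      using copy_is_biclique[OF copy s] cls by auto
    have fin: "finite A" "finite B" using AB finite_subset by blast+
    have ne: "A \<noteq> {}" "B \<noteq> {}" using card s cls by auto
    have eq: "d x y = d x' y'" if "x \<in> A" "y \<in> B" "x' \<in> A" "y' \<in> B" for x y x' y'
    proof -
      have "{Inl x, Inr y} \<in> edges F" "{Inl x', Inr y'} \<in> edges F"
        using that by (auto simp: e biclique_def)
      then have "c {Inl x, Inr y} = c {Inl x', Inr y'}"
        using mono unfolding monochromatic_def by blast
      then show ?thesis by simp
    qed
    show False
    proof (cases "\<exists>x\<in>A. \<exists>y\<in>B. cl x = cl y")
      case True
      then obtain x0 y0 where xy: "x0 \<in> A" "y0 \<in> B" "cl x0 = cl y0" by blast
      define i where "i = cl x0"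
      have "d x0 y0 = i" "i \<le> m" using xy by (auto simp: d_def i_def cl_def)
      then have same: "cl x = i \<and> cl y = i" if "x \<in> A" "y \<in> B" for x y
        using eq[OF xy(1,2) that] by (auto simp: d_def split: if_splits)
      have few: "card M < t" if "M \<subseteq> {..<N}" "\<And>x. x \<in> M \<Longrightarrow> cl x = i" for M
      proof (cases "i = m")
        case True
        have "M \<subseteq> {m..<N}" 
        proof
          fix x assume "x \<in> M"
          then have "cl x = m" "x < N" using that True by auto
          then show "x \<in> {m..<N}" by (simp add: cl_def min_def split: if_splits)
        qed
        then have "card M \<le> N - m" using card_mono[of "{m..<N}" M] by simp
        then show ?thesis using cls by simp
      next
        case False
        have "M \<subseteq> {i}" 
        proof
          fix x assume "x \<in> M"
          then have "cl x = i" using that(2) by simp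
          then show "x \<in> {i}" using False by (simp add: cl_def min_def split: if_splits)
        qed
        then have "card M \<le> 1" using card_mono[of "{i}" M] by simp
        then show ?thesis using cls by simp
      qed
      have "card A < t" "card B < t"
        using few[OF AB(1)] few[OF AB(2)] same ne by blast+
      then show False using card by auto
    next
      case False
      \<comment> \<open>As sets of natural numbers, the two parts are disjoint, because both sides use the same classes.\<close>
      then have "A \<inter> B = {}" by blast
      then have "card A + card B = card (A \<union> B)" using fin by (simp add: card_Un_disjoint)
      also have "\<dots> \<le> N" using card_mono[of "{..<N}" "A \<union> B"] AB by simp
      finally show False using card N by auto
    qed
  qed
  show thesis using that[OF exact norainbow] nomono by blast
qed

section \<open>The value of the Gallai-Ramsey number\<close>

theorem theorem4p2:
  fixes s t k :: nat
  assumes "2 \<le> s" and "s < t" and "t \<ge> 5"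
    and "t + s - t div 2 \<le> k" and "k \<le> t + s"
  shows "bgr k (complete_bipartite 1 3) (complete_bipartite s t) = enat (t + s)"
proof (rule antisym)
  let ?K = "complete_bipartite 1 3" and ?H = "complete_bipartite s t"
  have "t + s \<le> (t + s)\<^sup>2" by (simp add: power2_eq_square)
  then have "bgr_bound k ?K ?H (t + s)"
    using monochromatic_biclique_exists[OF assms(1,3,4)] assms(5)
    unfolding bgr_bound_def by (meson le_trans)
  then show "bgr k ?K ?H \<le> enat (t + s)"
    unfolding bgr_def by (intro Inf_lower) blast
  have "t + s \<le> n" if n: "bgr_bound k ?K ?H n" for n
  proof (rule ccontr)
    assume "\<not> t + s \<le> n"
    then have "n \<le> t + s - 1" by simp
    obtain c where "exact_edge_coloring (k - 2 + 2) (complete_bipartite (t + s - 1) (t + s - 1)) c"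
      and "\<not> (\<exists>F. is_copy ?K F (complete_bipartite (t + s - 1) (t + s - 1)) \<and> rainbow c F)"
      and "\<not> (\<exists>F. is_copy ?H F (complete_bipartite (t + s - 1) (t + s - 1)) \<and> monochromatic c F)"
      by (rule extremal_coloring[of s "k - 2" "t + s - 1" t]) (use assms in linarith)+
    moreover have "k - 2 + 2 = k" using assms by linarith
    ultimately show False using n \<open>n \<le> t + s - 1\<close> unfolding bgr_bound_def by metis
  qed
  then show "enat (t + s) \<le> bgr k ?K ?H"
    unfolding bgr_def by (intro Inf_greatest) auto
qed

end
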